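(* Let $N\ge1$, $g>0$, $h>0$, and let $\tilde A_H(W)\in\mathbb{R}^{(2N+3)\times(2N+3)}$ be the $x$-direction coefficient matrix of the HSWME in the reordered variables (defined in the context). Suppose $\alpha_1=0$. Then the eigenvalues of $\tilde A_H(W)$ are real and are given by $$\lambda_{1,2}=u_m\pm\sqrt{gh},\qquad \lambda_i=u_m,\quad i=3,4,\dots,2N+3.$$ Furthermore, writing vectors as $q=(q_{1,1},\dots,q_{1,N+2},q_{2,1},\dots,q_{2,N+1})^T\in\mathbb{R}^{2N+3}$, the eigenspace $E$ of the eigenvalue $u_m$ is as follows. 1. If $\beta_1=0$, then $E=\{q\in\mathbb{R}^{2N+3}: q_{1,1}=q_{1,2}=0\}$, with $\dim E=2N+1$; thus $\tilde A_H(W)$ is real diagonalizable. 2. If $\beta_1\neq0$, then $E=\{q\in\mathbb{R}^{2N+3}: q_{1,i}=0,\ 1\le i\le N+2\}$, with $\dim E=N+1$; thus $\tilde A_H(W)$ is not real diagonalizable.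
   Context: Variables: $W=(h,hu_m,h\alpha_1,\dots,h\alpha_N,hv_m,h\beta_1,\dots,h\beta_N)^T$. The matrix depends only on $h,u_m,v_m,\alpha_1,\beta_1\in\mathbb{R}$ and the constant $g$: $$\tilde A_H(W)=\begin{pmatrix}\tilde A_{11}&0\\\tilde A_{21}&\tilde A_{22}\end{pmatrix},$$ with $\tilde A_{11}\in\mathbb{R}^{(N+2)\times(N+2)}$, $\tilde A_{21}\in\mathbb{R}^{(N+1)\times(N+2)}$, $\tilde A_{22}\in\mathbb{R}^{(N+1)\times(N+1)}$. All entries not listed below are $0$; entries are listed only when their indices lie in range. $\tilde A_{11}$: entry $(1,2)$ is $1$; row 2 has entries $(2,1)=gh-u_m^2-\frac13\alpha_1^2$, $(2,2)=2u_m$, $(2,3)=\frac23\alpha_1$; for $k=1,\dots,N$, row $k+2$ has diagonal entry $u_m$, entry $(k+2,k+3)=\frac{k+2}{2k+3}\alpha_1$ (for $k\le N-1$), entry $(k+2,k+1)$ equal to $2\alpha_1$ if $k=1$ and $\frac{k-1}{2k-1}\alpha_1$ if $k\ge2$; and $(3,1)=-2u_m\alpha_1$, $(4,1)=-\frac23\alpha_1^2$ (the latter if $N\ge2$). $\tilde A_{21}$: row 1 has entries $(1,1)=-u_mv_m-\frac13\alpha_1\beta_1$, $(1,2)=v_m$, $(1,3)=\frac13\beta_1$; row 2 has entries $(2,1)=-(u_m\beta_1+v_m\alpha_1)$, $(2,2)=\beta_1$, $(2,4)=\frac15\beta_1$ (if $N\ge2$); for $k=2,\dots,N$, row $k+1$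 has entries $(k+1,k+1)=-\frac{1}{2k-1}\beta_1$, $(k+1,k+3)=\frac1{2k+3}\beta_1$ (for $k\le N-1$); and $(3,1)=-\frac23\alpha_1\beta_1$ (if $N\ge2$). $\tilde A_{22}$: tridiagonal, with diagonal entries $u_m$, entries $(k,k+1)=\frac{k}{2k+1}\alpha_1$ and $(k+1,k)=\frac{k}{2k-1}\alpha_1$ for $k=1,\dots,N$. "Real diagonalizable" means diagonalizable over $\mathbb{R}$. The assumption $gh>0$ is a standing assumption ($h$ is the water height, $g$ the gravitational constant). *)

theory Defs
  imports "Jordan_Normal_Form.Spectral_Radius"
begin

text \<open>The entry functions use the customary index origin 1 for rows and columns; the shift to the
  index origin 0 of the matrix library takes place in \<open>hswme_A11\<close>, \<open>hswme_A21\<close>, \<open>hswme_A22\<close>.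
  Entries outside the range of the matrix are simply never used, which accounts for side conditions
  such as \<open>N \<ge> 2\<close> or \<open>k \<le> N - 1\<close>.\<close>

definition entry_A11 :: "real \<Rightarrow> real \<Rightarrow> real \<Rightarrow> real \<Rightarrow> nat \<Rightarrow> nat \<Rightarrow> real" where
  "entry_A11 g h um \<alpha>1 i j =
    (if i = 1 then
       (if j = 2 then 1 else 0)
     else if i = 2 then
       (if j = 1 then g * h - um\<^sup>2 - 1/3 * \<alpha>1\<^sup>2
        else if j = 2 then 2 * um
        else if j = 3 then 2/3 * \<alpha>1
        else 0)
     else let k = i - 2 in
       (if j = k + 2 then um
        else if j = k + 3 then (real k + 2) / (2 * real k + 3) * \<alpha>1
        else if j = k + 1 then
          (if k = 1 then 2 * \<alpha>1 else (real k - 1) / (2 * real k - 1) * \<alpha>1)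
        else if i = 3 \<and> j = 1 then - 2 * um * \<alpha>1
        else if i = 4 \<and> j = 1 then - (2/3) * \<alpha>1\<^sup>2
        else 0))"

definition entry_A21 :: "real \<Rightarrow> real \<Rightarrow> real \<Rightarrow> real \<Rightarrow> nat \<Rightarrow> nat \<Rightarrow> real" where
  "entry_A21 um vm \<alpha>1 \<beta>1 i j =
    (if i = 1 then
       (if j = 1 then - um * vm - 1/3 * \<alpha>1 * \<beta>1
        else if j = 2 then vm
        else if j = 3 then 1/3 * \<beta>1
        else 0)
     else if i = 2 then
       (if j = 1 then - (um * \<beta>1 + vm * \<alpha>1)
        else if j = 2 then \<beta>1
        else if j = 4 then 1/5 * \<beta>1
        else 0)
     else let k = i - 1 in
       (if j = k + 1 then - (1 / (2 * real k - 1)) * \<beta>1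
        else if j = k + 3 then 1 / (2 * real k + 3) * \<beta>1
        else if i = 3 \<and> j = 1 then - (2/3) * \<alpha>1 * \<beta>1
        else 0))"

definition entry_A22 :: "real \<Rightarrow> real \<Rightarrow> nat \<Rightarrow> nat \<Rightarrow> real" where
  "entry_A22 um \<alpha>1 i j =
    (if j = i then um
     else if j = i + 1 then real i / (2 * real i + 1) * \<alpha>1
     else if i = j + 1 then real j / (2 * real j - 1) * \<alpha>1
     else 0)"

definition hswme_A11 :: "nat \<Rightarrow> real \<Rightarrow> real \<Rightarrow> real \<Rightarrow> real \<Rightarrow> real mat" where
  "hswme_A11 N g h um \<alpha>1 =
    mat (N + 2) (N + 2) (\<lambda>(i, j). entry_A11 g h um \<alpha>1 (i + 1) (j + 1))"

definition hswme_A21 :: "nat \<Rightarrow> real \<Rightarrow> real \<Rightarrow> real \<Rightarrow> real \<Rightarrow> real mat" where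
  "hswme_A21 N um vm \<alpha>1 \<beta>1 =
    mat (N + 1) (N + 2) (\<lambda>(i, j). entry_A21 um vm \<alpha>1 \<beta>1 (i + 1) (j + 1))"

definition hswme_A22 :: "nat \<Rightarrow> real \<Rightarrow> real \<Rightarrow> real mat" where
  "hswme_A22 N um \<alpha>1 =
    mat (N + 1) (N + 1) (\<lambda>(i, j). entry_A22 um \<alpha>1 (i + 1) (j + 1))"

text \<open>The coefficient matrix in the state
  \<open>W = (h, h u\<^sub>m, h \<alpha>\<^sub>1, \<dots>, h \<alpha>\<^sub>N, h v\<^sub>m, h \<beta>\<^sub>1, \<dots>, h \<beta>\<^sub>N)\<close> depends on \<open>W\<close> only through
  the arguments below.\<close>

definition hswme_A :: "nat \<Rightarrow> real \<Rightarrow> real \<Rightarrow> real \<Rightarrow> real \<Rightarrow> real \<Rightarrow> real \<Rightarrow> real mat" where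
  "hswme_A N g h um vm \<alpha>1 \<beta>1 =
    four_block_mat
      (hswme_A11 N g h um \<alpha>1)          (0\<^sub>m (N + 2) (N + 1))
      (hswme_A21 N um vm \<alpha>1 \<beta>1)        (hswme_A22 N um \<alpha>1)"

lemma hswme_A_carrier: "hswme_A N g h um vm \<alpha>1 \<beta>1 \<in> carrier_mat (2 * N + 3) (2 * N + 3)"
proof -
  have "hswme_A N g h um vm \<alpha>1 \<beta>1 \<in> carrier_mat ((N + 2) + (N + 1)) ((N + 2) + (N + 1))"
    unfolding hswme_A_def
    by (rule four_block_carrier_mat) (simp_all add: hswme_A11_def hswme_A22_def)
  moreover have "(N + 2) + (N + 1) = 2 * N + 3" by simp
  ultimately show ?thesis by metis
qed

definition eigenspace :: "real mat \<Rightarrow> real \<Rightarrow> real vec set" where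
  "eigenspace A ev = {q \<in> carrier_vec (dim_row A). A *\<^sub>v q = ev \<cdot>\<^sub>v q}"

text \<open>Meaningful when \<open>W\<close> is a linear subspace of the \<open>n\<close>-dimensional coordinate space.\<close>

definition subspace_dim :: "nat \<Rightarrow> real vec set \<Rightarrow> nat" where
  "subspace_dim n W = vectorspace.dim class_ring (module_vec TYPE(real) n\<lparr>carrier := W\<rparr>)"

text \<open>Similarity is witnessed by matrices of the same element type, hence over the reals.\<close>

definition real_diagonalizable :: "real mat \<Rightarrow> bool" where
  "real_diagonalizable A \<longleftrightarrow> (\<exists>D. diagonal_mat D \<and> similar_mat A D)"

end

theory Submission
  imports Defs "Jordan_Normal_Form.Matrix_Kernel"
begin

text \<open>For \<open>\<alpha>\<^sub>1 = 0\<close> the matrix is block lower triangular with respect to the splitting into the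
  first two and the remaining coordinates: the leading block has the eigenvalues
  \<open>u\<^sub>m \<plusminus> sqrt (g h)\<close>, and the trailing block is itself lower triangular with diagonal \<open>u\<^sub>m\<close>. This gives
  the characteristic polynomial. The first two rows of \<open>A q = u\<^sub>m q\<close> force \<open>q\<^sub>1\<^sub>,\<^sub>1 = q\<^sub>1\<^sub>,\<^sub>2 = 0\<close> because
  \<open>g h \<noteq> 0\<close>. If \<open>\<beta>\<^sub>1 = 0\<close> nothing else is required, and the two remaining eigenvectors complete a
  basis. If \<open>\<beta>\<^sub>1 \<noteq> 0\<close>, row \<open>r\<close> of the lower left block successively forces \<open>q\<^sub>1\<^sub>,\<^sub>r\<^sub>+\<^sub>2 = 0\<close>; moreover the
  third unit vector is killed by \<open>(A - u\<^sub>m)\<^sup>2\<close> but not by \<open>A - u\<^sub>m\<close>, so \<open>A\<close> is not diagonalizable.\<close>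

section \<open>Characteristic polynomials, eigenvectors and diagonalizability\<close>

lemma char_poly_four_block_mat_upper_right_zero:
  fixes A :: "'a :: idom mat"
  assumes A: "A \<in> carrier_mat n n" and C: "C \<in> carrier_mat m n" and D: "D \<in> carrier_mat m m"
  shows "char_poly (four_block_mat A (0\<^sub>m n m) C D) = char_poly A * char_poly D"
proof -
  have "char_poly_matrix (four_block_mat A (0\<^sub>m n m) C D) =
      four_block_mat (char_poly_matrix A) (0\<^sub>m n m) (map_mat (\<lambda>a. [:- a:]) C) (char_poly_matrix D)"
    using A C D by (intro eq_matI) (auto simp: char_poly_matrix_def one_poly_def)
  then show ?thesis
    unfolding char_poly_def
    using A C D by (simp add: det_four_block_mat_upper_right_zero[of _ n _ m])
qed

lemma det_2:
  fixes A :: "'a :: idom mat"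
  assumes A: "A \<in> carrier_mat 2 2"
  shows "det A = A $$ (0,0) * A $$ (1,1) - A $$ (0,1) * A $$ (1,0)"
proof -
  have "mat_delete A i j \<in> carrier_mat 1 1" for i j
    using A mat_delete_carrier[of A 2 2 i j] by simp
  then have d: "det (mat_delete A i j) = mat_delete A i j $$ (0,0)" for i j
    by (rule det_single)
  have "det A = (\<Sum>j<2. A $$ (0,j) * cofactor A 0 j)"
    by (rule laplace_expansion_row[OF A]) simp
  also have "\<dots> = A $$ (0,0) * A $$ (1,1) - A $$ (0,1) * A $$ (1,0)"
    unfolding cofactor_def d using A by (simp add: mat_delete_def numeral_2_eq_2)
  finally show ?thesis .
qed

lemma char_poly_2:
  fixes A :: "'a :: idom mat"
  assumes A: "A \<in> carrier_mat 2 2"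
  shows "char_poly A =
    [:A $$ (0,0) * A $$ (1,1) - A $$ (0,1) * A $$ (1,0), - (A $$ (0,0) + A $$ (1,1)), 1:]"
proof -
  have "char_poly A = det (char_poly_matrix A)"
    by (simp add: char_poly_def)
  also have "\<dots> = [:- A $$ (0,0), 1:] * [:- A $$ (1,1), 1:] - [:- A $$ (0,1):] * [:- A $$ (1,0):]"
    using A by (subst det_2) (auto simp: char_poly_matrix_def)
  finally show ?thesis by simp
qed

text \<open>Transposition keeps the characteristic polynomial and makes the matrix upper triangular,
  where the factors are read off the diagonal.\<close>

lemma char_poly_lower_triangular_const_diag:
  fixes A :: "'a :: idom mat"
  assumes A: "A \<in> carrier_mat n n"
    and lower: "\<And>i j. i < j \<Longrightarrow> j < n \<Longrightarrow> A $$ (i, j) = 0"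
    and diag: "\<And>i. i < n \<Longrightarrow> A $$ (i, i) = d"
  shows "char_poly A = [:- d, 1:] ^ n"
proof -
  have T: "transpose_mat A \<in> carrier_mat n n" "upper_triangular (transpose_mat A)"
    using A lower by (auto simp: upper_triangular_def)
  have "diag_mat (transpose_mat A) = replicate n d"
    using A diag by (intro nth_equalityI) (auto simp: diag_mat_def)
  then have "char_poly (transpose_mat A) = [:- d, 1:] ^ n"
    using char_poly_upper_triangular[OF T] by simp
  then show ?thesis
    using char_poly_transpose_mat[OF A] by simp
qed

lemma poly_linear_factors_eq_0_iff:
  fixes a b c z :: "'a :: idom"
  assumes "k > 0"
  shows "poly ([:- a, 1:] * [:- b, 1:] * [:- c, 1:] ^ k) z = 0 \<longleftrightarrow> z = a \<or> z = b \<or> z = c"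
proof -
  have "poly [:- d, 1:] z = 0 \<longleftrightarrow> z = d" for d
    by simp
  then show ?thesis
    using assms unfolding poly_mult poly_power by auto
qed

section \<open>Matrix-vector products, diagonalizability and dimension\<close>

lemma mult_mat_vec_index_support:
  fixes A :: "'a :: comm_ring_1 mat"
  assumes A: "A \<in> carrier_mat m n" and v: "v \<in> carrier_vec n" and i: "i < m" and S: "S \<subseteq> {..<n}"
    and zero: "\<And>j. j < n \<Longrightarrow> j \<notin> S \<Longrightarrow> A $$ (i, j) * v $ j = 0"
  shows "(A *\<^sub>v v) $ i = (\<Sum>j\<in>S. A $$ (i, j) * v $ j)"
proof -
  have "(A *\<^sub>v v) $ i = (\<Sum>j\<in>{0..<n}. A $$ (i,j) * v $ j)"
    using i A v by (auto simp: scalar_prod_def)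
  also have "\<dots> = (\<Sum>j\<in>S. A $$ (i,j) * v $ j)"
    using S zero by (intro sum.mono_neutral_right) auto
  finally show ?thesis .
qed

text \<open>Here \<open>w\<close> is \<open>(A - a) v\<close>, so \<open>v\<close> lies in the
  kernel of \<open>(A - a)^2\<close>. For a diagonalizable matrix this kernel is that of
  \<open>A - a\<close>, because a diagonal entry whose square vanishes is zero.\<close>

lemma real_diagonalizable_ker_square:
  assumes diag: "real_diagonalizable A" and A: "A \<in> carrier_mat n n"
    and v: "v \<in> carrier_vec n" and w: "w \<in> carrier_vec n"
    and Av: "A *\<^sub>v v = a \<cdot>\<^sub>v v + w" and Aw: "A *\<^sub>v w = a \<cdot>\<^sub>v w"
  shows "w = 0\<^sub>v n"
proof -
  from diag obtain D P Q where D: "diagonal_mat D" and "similar_mat_wit A D P Q"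
    unfolding real_diagonalizable_def similar_mat_def by blast
  note wit = similar_mat_witD2[OF A this(2)]
  note [simp] = wit(4-7) v w carrier_matD[OF wit(5)] carrier_matD[OF wit(6)] carrier_matD[OF wit(7)]
  have diag_mult: "(D *\<^sub>v x) $ i = D $$ (i,i) * x $ i" if "i < n" "x \<in> carrier_vec n" for x i
    using mult_mat_vec_index_support[OF wit(5) that(2,1), of "{i}"] that D wit(5)
    by (auto simp: diagonal_mat_def)
  \<comment> \<open>\<open>Q\<close> intertwines \<open>A\<close> with \<open>D\<close>, which turns
    both relations into scalar equations in each coordinate.\<close>
  have QA: "Q *\<^sub>v (A *\<^sub>v x) = D *\<^sub>v (Q *\<^sub>v x)" if x: "x \<in> carrier_vec n" for x
  proof -
    have "Q * A = (Q * P) * (D * Q)"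
      unfolding wit(3) using wit(4-7)
      by (smt (verit, best) assoc_mult_mat mult_carrier_mat)
    then have "Q * A = D * Q"
      using wit by simp
    then show ?thesis
      using x wit(4-7) by (metis assoc_mult_mat_vec)
  qed
  have "(Q *\<^sub>v w) $ i = 0" if i: "i < n" for i
  proof -
    have "D *\<^sub>v (Q *\<^sub>v v) = a \<cdot>\<^sub>v (Q *\<^sub>v v) + Q *\<^sub>v w"
      using QA[OF v] unfolding Av by (simp add: mult_add_distrib_mat_vec[of _ n n] mult_mat_vec[of _ n n])
    then have 1: "D $$ (i,i) * (Q *\<^sub>v v) $ i = a * (Q *\<^sub>v v) $ i + (Q *\<^sub>v w) $ i"
      using i diag_mult[OF i, of "Q *\<^sub>v v"] wit(7) by auto
    have "D *\<^sub>v (Q *\<^sub>v w) = a \<cdot>\<^sub>v (Q *\<^sub>v w)"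
      using QA[OF w] unfolding Aw by (simp add: mult_mat_vec[of _ n n])
    then have 2: "D $$ (i,i) * (Q *\<^sub>v w) $ i = a * (Q *\<^sub>v w) $ i"
      using i diag_mult[OF i, of "Q *\<^sub>v w"] wit(7) by auto
    \<comment> \<open>If \<open>D $$ (i,i) = a\<close>, the first equation gives the claim;
      otherwise the second does.\<close>
    from 1 2 show ?thesis by auto
  qed
  then have "Q *\<^sub>v w = 0\<^sub>v n"
    using wit(7) by (intro eq_vecI) auto
  then have "P *\<^sub>v (Q *\<^sub>v w) = 0\<^sub>v n"
    using wit(6) by (intro eq_vecI) auto
  then show ?thesis
    using wit(1,6,7) w by (metis assoc_mult_mat_vec one_mult_mat_vec)
qed

text \<open>The subspace is the kernel of the block row \<open>(I 0)\<close>, which is already in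
  row echelon form with \<open>m\<close> nonzero rows, so its dimension can be read off.\<close>

lemma subspace_dim_initial_zeros:
  assumes "m \<le> n"
  shows "subspace_dim n {q \<in> carrier_vec n. \<forall>i<m. q $ i = 0} = n - m"
proof -
  define M :: "real mat" where "M = mat m n (\<lambda>(i, j). if i = j then 1 else 0)"
  have M: "M \<in> carrier_mat m n" by (simp add: M_def)
  have "(M *\<^sub>v q) $ i = q $ i" if "i < m" "q \<in> carrier_vec n" for q i
    using mult_mat_vec_index_support[OF M that(2,1), of "{i}"] that assms by (auto simp: M_def)
  then have ker: "mat_kernel M = {q \<in> carrier_vec n. \<forall>i<m. q $ i = 0}"
    unfolding mat_kernel[OF M] using M by (auto simp: vec_eq_iff)
  have "pivot_fun M (\<lambda>i. i) n"
    using assms by (intro pivot_funI[of _ m]) (auto simp: M_def)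
  then have "row_echelon_form M"
    unfolding row_echelon_form_def using M by auto
  then have "subspace_dim n (mat_kernel M) = n - card {i. i < m \<and> row M i \<noteq> 0\<^sub>v n}"
    unfolding subspace_dim_def by (rule find_base_vectors(6)[OF _ M])
  also have "{i. i < m \<and> row M i \<noteq> 0\<^sub>v n} = {..<m}"
  proof -
    have "row M i \<noteq> 0\<^sub>v n" if "i < m" for i
    proof
      assume "row M i = 0\<^sub>v n"
      then have "row M i $ i = 0\<^sub>v n $ i" by simp
      then show False using that assms by (simp add: M_def)
    qed
    then show ?thesis by auto
  qed
  finally show ?thesis by (simp add: ker)
qed

lemma mult_mat_vec_eq_smult:
  fixes A :: "'a :: comm_ring_1 mat"
  assumes A: "A \<in> carrier_mat n n" and v: "v \<in> carrier_vec n"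
    and off: "\<And>i j. i < n \<Longrightarrow> j < n \<Longrightarrow> i \<noteq> j \<Longrightarrow> A $$ (i, j) * v $ j = 0"
    and diag: "\<And>i. i < n \<Longrightarrow> A $$ (i, i) * v $ i = a * v $ i"
  shows "A *\<^sub>v v = a \<cdot>\<^sub>v v"
proof (rule eq_vecI)
  fix i assume "i < dim_vec (a \<cdot>\<^sub>v v)"
  then have i: "i < n" using v by simp
  then show "(A *\<^sub>v v) $ i = (a \<cdot>\<^sub>v v) $ i"
    using mult_mat_vec_index_support[OF A v i, of "{i}"] off[OF i] diag[OF i] v by auto
qed (use A v in auto)

section \<open>Scalar matrices modified in the first two columns\<close>

text \<open>For \<open>\<beta>1 = 0\<close> the coefficient matrix, its diagonal form, the
  eigenvector matrix and the inverse of the latter all have this shape. It is closed under products,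
  so identities between them reduce to comparing two columns and a scalar.\<close>

definition two_col_mat :: "nat \<Rightarrow> (nat \<Rightarrow> 'a) \<Rightarrow> (nat \<Rightarrow> 'a) \<Rightarrow> 'a \<Rightarrow> 'a :: zero mat" where
  "two_col_mat n f0 f1 d =
    mat n n (\<lambda>(i, j). if j = 0 then f0 i else if j = 1 then f1 i else if i = j then d else 0)"

lemma two_col_mat_carrier: "two_col_mat n f0 f1 d \<in> carrier_mat n n"
  by (simp add: two_col_mat_def)

lemma two_col_mat_mult:
  fixes d e :: "'a :: comm_ring_1"
  assumes n: "n \<ge> 2"
  shows "two_col_mat n f0 f1 d * two_col_mat n g0 g1 e =
    two_col_mat n (\<lambda>i. f0 i * g0 0 + f1 i * g0 1 + (if i \<ge> 2 then d * g0 i else 0))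
      (\<lambda>i. f0 i * g1 0 + f1 i * g1 1 + (if i \<ge> 2 then d * g1 i else 0)) (d * e)"
    (is "?F * ?G = ?H")
proof (rule eq_matI)
  fix i j assume "i < dim_row ?H" "j < dim_col ?H"
  then have ij: "i < n" "j < n" by (auto simp: two_col_mat_def)
  have "(?F * ?G) $$ (i,j) = (\<Sum>k\<in>{0..<n}. ?F $$ (i,k) * ?G $$ (k,j))"
    using ij by (auto simp: scalar_prod_def two_col_mat_def)
  \<comment> \<open>Row \<open>i\<close> of the left factor lives in columns 0 and 1 and, if
    \<open>i \<ge> 2\<close>, on the diagonal.\<close>
  also have "\<dots> = (\<Sum>k\<in>{0,1} \<union> ({i} \<inter> {2..}). ?F $$ (i,k) * ?G $$ (k,j))"
    using ij n by (intro sum.mono_neutral_right) (auto simp: two_col_mat_def)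
  also have "\<dots> = f0 i * ?G $$ (0,j) + f1 i * ?G $$ (1,j) + (if i \<ge> 2 then d * ?G $$ (i,j) else 0)"
    using ij n by (auto simp: two_col_mat_def)
  also have "\<dots> = ?H $$ (i,j)"
    using ij n by (auto simp: two_col_mat_def)
  finally show "(?F * ?G) $$ (i,j) = ?H $$ (i,j)" .
qed (auto simp: two_col_mat_def)

section \<open>The coefficient matrix for \<open>\<alpha>\<^sub>1 = 0\<close>\<close>

context
  fixes N :: nat and g h um vm \<beta>1 :: real
begin

abbreviation "A0 \<equiv> hswme_A N g h um vm 0 \<beta>1"

lemma A0_row_0: "j < 2 * N + 3 \<Longrightarrow> A0 $$ (0, j) = (if j = 1 then 1 else 0)"
  by (auto simp: hswme_A_def hswme_A11_def hswme_A22_def entry_A11_def)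

lemma A0_row_1:
  "j < 2 * N + 3 \<Longrightarrow> A0 $$ (1, j) = (if j = 0 then g * h - um\<^sup>2 else if j = 1 then 2 * um else 0)"
  by (auto simp: hswme_A_def hswme_A11_def hswme_A22_def entry_A11_def)

lemma A0_upper:
  "2 \<le> i \<Longrightarrow> i < N + 2 \<Longrightarrow> j < 2 * N + 3 \<Longrightarrow> A0 $$ (i, j) = (if i = j then um else 0)"
  by (auto simp: hswme_A_def hswme_A11_def hswme_A22_def entry_A11_def Let_def)

lemma A0_lower_right:
  "N + 2 \<le> i \<Longrightarrow> i < 2 * N + 3 \<Longrightarrow> N + 2 \<le> j \<Longrightarrow> j < 2 * N + 3 \<Longrightarrow>
    A0 $$ (i, j) = (if i = j then um else 0)"
  by (auto simp: hswme_A_def hswme_A11_def hswme_A22_def entry_A22_def)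

lemma A0_lower_left:
  "r \<le> N \<Longrightarrow> j < N + 2 \<Longrightarrow> A0 $$ (N + 2 + r, j) = entry_A21 um vm 0 \<beta>1 (r + 1) (j + 1)"
  by (simp add: hswme_A_def hswme_A11_def hswme_A22_def hswme_A21_def)

text \<open>One formula covers the separate clauses for the first, second and later rows. By the
  next lemma this entry is the last one in its row of the block that can be nonzero.\<close>

lemma A0_lower_left_superdiag: "r < N \<Longrightarrow> A0 $$ (N + 2 + r, r + 2) = \<beta>1 / (2 * real r + 3)"
  by (subst A0_lower_left) (auto simp: entry_A21_def)

lemma A0_lower_left_zero: "r \<le> N \<Longrightarrow> r + 2 < j \<Longrightarrow> j < N + 2 \<Longrightarrow> A0 $$ (N + 2 + r, j) = 0"
  by (subst A0_lower_left) (auto simp: entry_A21_def)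

lemma A0_trailing:
  assumes "2 \<le> i" "i \<le> j" "j < 2 * N + 3"
  shows "A0 $$ (i, j) = (if i = j then um else 0)"
  using assms A0_upper[of i j] A0_lower_right[of i j] by (cases "i < N + 2") auto

section \<open>The characteristic polynomial\<close>

lemma char_poly_A0:
  assumes gh: "g * h > 0"
  shows "char_poly A0 =
    [:- (um + sqrt (g * h)), 1:] * [:- (um - sqrt (g * h)), 1:] * [:- um, 1:] ^ (2 * N + 1)"
proof -
  define B where "B = mat 2 2 (\<lambda>ij. A0 $$ ij)"
  define C where "C = mat (2 * N + 1) 2 (\<lambda>(i, j). A0 $$ (i + 2, j))"
  define D where "D = mat (2 * N + 1) (2 * N + 1) (\<lambda>(i, j). A0 $$ (i + 2, j + 2))"
  have "A0 = four_block_mat B (0\<^sub>m 2 (2 * N + 1)) C D" (is "_ = ?M")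
  proof (rule eq_matI)
    fix i j assume "i < dim_row ?M" "j < dim_col ?M"
    then have ij: "i < 2 * N + 3" "j < 2 * N + 3" by (auto simp: B_def D_def)
    show "A0 $$ (i, j) = ?M $$ (i, j)"
    proof (cases "i < 2 \<and> 2 \<le> j")
      case True
      then have "A0 $$ (i, j) = 0"
        using ij A0_row_0[of j] A0_row_1[of j] by (elim conjE less_2_cases[THEN disjE]) auto
      with True ij show ?thesis by (simp add: B_def D_def)
    next
      case False
      have "Suc (Suc (k - 2)) = k" if "\<not> k < 2" for k
        using that by simp
      with False ij show ?thesis
        by (cases "i < 2"; cases "j < 2") (simp_all add: B_def C_def D_def)
    qed
  qed (use hswme_A_carrier[of N g h um vm 0 \<beta>1] in \<open>auto simp: B_def D_def\<close>)
  then have "char_poly A0 = char_poly B * char_poly D"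
    using char_poly_four_block_mat_upper_right_zero[of B 2 C "2 * N + 1" D]
    by (simp add: B_def C_def D_def)
  moreover have "char_poly D = [:- um, 1:] ^ (2 * N + 1)"
    by (rule char_poly_lower_triangular_const_diag) (auto simp: D_def A0_trailing)
  \<comment> \<open>The leading block has trace \<open>2 * um\<close> and determinant
    \<open>um^2 - g * h\<close>, the sum and product of the two claimed roots.\<close>
  moreover have "char_poly B = [:- (um + sqrt (g * h)), 1:] * [:- (um - sqrt (g * h)), 1:]"
    using gh A0_row_0[of 0] A0_row_0[of 1] A0_row_1[of 0] A0_row_1[of 1]
    by (subst char_poly_2) (auto simp: B_def algebra_simps power2_eq_square)
  ultimately show ?thesis by simp
qed

section \<open>The eigenspace of \<open>um\<close>, and failure of diagonalizability for
  \<open>\<beta>1 \<noteq> 0\<close>\<close>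

lemma A0_eigenvector_leading:
  assumes gh: "g * h \<noteq> 0" and q: "q \<in> carrier_vec (2 * N + 3)" and eig: "A0 *\<^sub>v q = um \<cdot>\<^sub>v q"
  shows "q $ 0 = 0" "q $ 1 = 0"
proof -
  have "(A0 *\<^sub>v q) $ 0 = (\<Sum>j\<in>{1}. A0 $$ (0,j) * q $ j)"
    by (rule mult_mat_vec_index_support[OF hswme_A_carrier q]) (auto simp: A0_row_0)
  then have 0: "q $ 1 = um * q $ 0"
    using q by (simp add: eig A0_row_0[of 1, simplified])
  have "(A0 *\<^sub>v q) $ 1 = (\<Sum>j\<in>{0,1}. A0 $$ (1,j) * q $ j)"
    by (rule mult_mat_vec_index_support[OF hswme_A_carrier q]) (use A0_row_1 in auto)
  then have "um * q $ 1 = (g * h - um\<^sup>2) * q $ 0 + 2 * um * q $ 1"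
    using q A0_row_1[of 0] A0_row_1[of 1] by (simp add: eig)
  then have "g * h * q $ 0 = 0"
    unfolding 0 by (simp add: algebra_simps power2_eq_square)
  with gh show "q $ 0 = 0" by simp
  with 0 show "q $ 1 = 0" by simp
qed

text \<open>Such a \<open>q\<close> meets only the last \<open>N + 1\<close> columns, where the
  upper block is zero and the lower block is \<open>um\<close> times the identity.\<close>

lemma eigenvector_if_upper_zero:
  assumes q: "q \<in> carrier_vec (2 * N + 3)" and zero: "\<And>i. i < N + 2 \<Longrightarrow> q $ i = 0"
  shows "A0 *\<^sub>v q = um \<cdot>\<^sub>v q"
proof (rule mult_mat_vec_eq_smult[OF hswme_A_carrier q])
  fix i j assume "i < 2 * N + 3" "j < 2 * N + 3" "i \<noteq> j"
  then show "A0 $$ (i, j) * q $ j = 0"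
    using zero[of j] A0_row_0[of j] A0_row_1[of j] A0_upper[of i j] A0_lower_right[of i j]
    by (cases "j < N + 2"; cases "i < N + 2"; cases "i < 2") (auto simp: less_2_cases_iff)
next
  fix i assume "i < 2 * N + 3"
  then show "A0 $$ (i, i) * q $ i = um * q $ i"
    using zero[of i] A0_lower_right[of i i] by (cases "i < N + 2") auto
qed

lemma eigenspace_A0_nonzero:
  assumes gh: "g * h \<noteq> 0" and \<beta>1: "\<beta>1 \<noteq> 0"
  shows "eigenspace A0 um = {q \<in> carrier_vec (2 * N + 3). \<forall>i<N + 2. q $ i = 0}"
proof -
  have "q $ i = 0" if q: "q \<in> carrier_vec (2 * N + 3)" and eig: "A0 *\<^sub>v q = um \<cdot>\<^sub>v q"
    and "i < N + 2" for q i
    using that(3)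
  proof (induction i rule: less_induct)
    case (less i)
    show ?case
    proof (cases "i < 2")
      case True
      then show ?thesis
        using A0_eigenvector_leading[OF gh q eig] by (auto simp: less_2_cases_iff)
    next
      case False
      define r where "r = i - 2"
      with False less.prems have i: "i = r + 2" and r: "r < N" by auto
      \<comment> \<open>Columns left of \<open>r + 2\<close> meet coordinates that vanish by
        induction; later ones in the lower left block have zero entries; the lower right block
        contributes its diagonal only.\<close>
      have "(A0 *\<^sub>v q) $ (N + 2 + r) =
          (\<Sum>j\<in>{r + 2, N + 2 + r}. A0 $$ (N + 2 + r, j) * q $ j)"
      proof (rule mult_mat_vec_index_support[OF hswme_A_carrier q])
        fix j assume "j < 2 * N + 3" "j \<notin> {r + 2, N + 2 + r}"
        then consider "j < i" | "i < j" "j < N + 2" | "N + 2 \<le> j" "j \<noteq> N + 2 + r" "j < 2 * N + 3"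
          using i by (cases "j < i"; cases "j < N + 2") auto
        then show "A0 $$ (N + 2 + r, j) * q $ j = 0"
        proof cases
          case 1
          then show ?thesis using less.IH[of j] less.prems by simp
        next
          case 2
          then show ?thesis using A0_lower_left_zero[of r j] r i by simp
        next
          case 3
          then show ?thesis using A0_lower_right[of "N + 2 + r" j] r by simp
        qed
      qed (use r in auto)
      then have "um * q $ (N + 2 + r) = \<beta>1 / (2 * real r + 3) * q $ i + um * q $ (N + 2 + r)"
        using r q A0_lower_left_superdiag[OF r] A0_lower_right[of "N + 2 + r" "N + 2 + r"]
        by (simp add: eig i)
      then have "\<beta>1 / (2 * real r + 3) * q $ i = 0" by simp
      moreover have "2 * real r + 3 \<noteq> 0" by linarith
      ultimately show ?thesis using \<beta>1 by simp
    qed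
  qed
  then show ?thesis
    unfolding eigenspace_def
    using hswme_A_carrier[of N g h um vm 0 \<beta>1] eigenvector_if_upper_zero by auto
qed

lemma A0_not_diagonalizable:
  assumes N: "N \<ge> 1" and \<beta>1: "\<beta>1 \<noteq> 0"
  shows "\<not> real_diagonalizable A0"
proof
  assume diag: "real_diagonalizable A0"
  \<comment> \<open>Since \<open>N \<ge> 1\<close>, index 2 is still in the upper half. Column 2 of
    \<open>A0 - um\<close> has zeros in all upper rows, so \<open>w\<close> is annihilated by
    \<open>A0 - um\<close>.\<close>
  define e :: "real vec" where "e = unit_vec (2 * N + 3) 2"
  define w where "w = A0 *\<^sub>v e - um \<cdot>\<^sub>v e"
  note A0 = hswme_A_carrier[of N g h um vm 0 \<beta>1]
  have e: "e \<in> carrier_vec (2 * N + 3)" by (simp add: e_def)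
  have w: "w \<in> carrier_vec (2 * N + 3)" using A0 by (simp add: w_def e_def)
  have wi: "w $ i = A0 $$ (i, 2) - (if i = 2 then um else 0)" if "i < 2 * N + 3" for i
    using that A0 N by (auto simp: w_def e_def)
  have "w $ i = 0" if "i < N + 2" for i
    using that N A0_row_0[of 2] A0_row_1[of 2] A0_upper[of i 2] wi[of i]
    by (cases "i < 2") (auto simp: less_2_cases_iff)
  then have "A0 *\<^sub>v w = um \<cdot>\<^sub>v w"
    by (rule eigenvector_if_upper_zero[OF w])
  moreover have "A0 *\<^sub>v e = um \<cdot>\<^sub>v e + w"
    using A0 e by (intro eq_vecI) (auto simp: w_def)
  ultimately have "w = 0\<^sub>v (2 * N + 3)"
    using real_diagonalizable_ker_square[OF diag A0 e w] by blast
  \<comment> \<open>The first lower coordinate of \<open>w\<close> shows that it is nonzero.\<close>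
  moreover have "A0 $$ (N + 2, 2) = \<beta>1 / 3"
    using A0_lower_left_superdiag[of 0] N by (simp add: numeral_2_eq_2)
  ultimately show False
    using wi[of "N + 2"] N \<beta>1 by simp
qed

end

section \<open>Explicit diagonalization for \<open>\<beta>1 = 0\<close>\<close>

context
  fixes N :: nat and g h um vm :: real
begin

abbreviation "A00 \<equiv> hswme_A N g h um vm 0 0"

lemma A00_eq_two_col_mat:
  "A00 = two_col_mat (2 * N + 3)
    (\<lambda>i. if i = 1 then g * h - um\<^sup>2 else if i = N + 2 then - um * vm else 0)
    (\<lambda>i. if i = 0 then 1 else if i = 1 then 2 * um else if i = N + 2 then vm else 0) um"
  (is "_ = ?T")
proof (rule eq_matI)
  fix i j assume "i < dim_row ?T" "j < dim_col ?T"
  then have ij: "i < 2 * N + 3" "j < 2 * N + 3" by (auto simp: two_col_mat_def)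
  show "A00 $$ (i, j) = ?T $$ (i, j)"
  proof (cases "i < N + 2 \<or> N + 2 \<le> j")
    case True
    then show ?thesis
      using ij A0_row_0[of j N g h um vm 0] A0_row_1[of j N g h um vm 0]
        A0_upper[of i N j g h um vm 0] A0_lower_right[of N i j g h um vm 0]
      by (cases "i < 2"; cases "i < N + 2") (auto simp: less_2_cases_iff two_col_mat_def)
  next
    case False
    define r where "r = i - (N + 2)"
    with False ij have i: "i = N + 2 + r" and r: "r \<le> N" and j: "j < N + 2" by auto
    \<comment> \<open>With both \<open>\<alpha>1\<close> and \<open>\<beta>1\<close> zero, only the
      first row of the lower left block survives.\<close>
    have "A00 $$ (i, j) = (if r = 0 \<and> j = 0 then - um * vm else if r = 0 \<and> j = 1 then vm else 0)"
      unfolding i A0_lower_left[OF r j]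
      by (cases "r = 0"; cases "r = 1"; cases "j = 0"; cases "j = 1") (simp_all add: entry_A21_def)
    with i j ij show ?thesis
      by (auto simp: two_col_mat_def)
  qed
qed (use hswme_A_carrier[of N g h um vm 0 0] in \<open>auto simp: two_col_mat_def\<close>)

lemma A00_diagonalizable:
  assumes gh: "g * h > 0"
  shows "real_diagonalizable A00"
proof -
  define c where "c = sqrt (g * h)"
  have c: "c \<noteq> 0" "g * h = c * c" using gh by (auto simp: c_def)
  let ?n = "2 * N + 3"
  define D where "D = two_col_mat ?n (\<lambda>i. if i = 0 then um + c else 0) (\<lambda>i. if i = 1 then um - c else 0) um"
  \<comment> \<open>The first two columns are eigenvectors
    \<open>(1, um + c, 0, ..., vm, 0, ...)\<close> and
    \<open>(1, um - c, 0, ..., vm, 0, ...)\<close> for \<open>um + c\<close> and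
    \<open>um - c\<close>, with \<open>vm\<close> at index \<open>N + 2\<close>; the others are unit
    vectors.\<close>
  define P where "P = two_col_mat ?n
    (\<lambda>i. if i = 0 then 1 else if i = 1 then um + c else if i = N + 2 then vm else 0)
    (\<lambda>i. if i = 0 then 1 else if i = 1 then um - c else if i = N + 2 then vm else 0) 1"
  \<comment> \<open>The inverse of \<open>P\<close>: the leading 2 by 2 block is inverted, and row
    \<open>N + 2\<close> is \<open>- vm\<close> times the sum of its two rows, that is
    \<open>(- vm, 0)\<close>, followed by the identity part.\<close>
  define Q where "Q = two_col_mat ?n
    (\<lambda>i. if i = 0 then (c - um) / (2 * c) else if i = 1 then (c + um) / (2 * c)
      else if i = N + 2 then - vm else 0)
    (\<lambda>i. if i = 0 then 1 / (2 * c) else if i = 1 then - 1 / (2 * c) else 0) 1"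
  have one: "1\<^sub>m ?n = two_col_mat ?n (\<lambda>i. if i = 0 then 1 else 0) (\<lambda>i. if i = 1 then 1 else (0::real)) 1"
    by (rule eq_matI) (auto simp: two_col_mat_def)
  have "similar_mat A00 D"
  proof (rule similar_matI[of _ _ P Q ?n])
    show "{A00, D, P, Q} \<subseteq> carrier_mat ?n ?n"
      using hswme_A_carrier by (simp add: D_def P_def Q_def two_col_mat_carrier)
    show "P * Q = 1\<^sub>m ?n"
      using c unfolding P_def Q_def one
      by (subst two_col_mat_mult, simp, intro arg_cong3[where f = "two_col_mat ?n"] ext)
        (auto simp: field_simps)
    show "Q * P = 1\<^sub>m ?n"
      using c unfolding P_def Q_def one
      by (subst two_col_mat_mult, simp, intro arg_cong3[where f = "two_col_mat ?n"] ext)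
        (auto simp: field_simps)
    show "A00 = P * D * Q"
      using c(1) unfolding A00_eq_two_col_mat P_def D_def Q_def c(2)
      by (subst two_col_mat_mult, simp, subst two_col_mat_mult, simp,
          intro arg_cong3[where f = "two_col_mat ?n"] ext)
        (auto simp: field_simps power2_eq_square)
  qed
  moreover have "diagonal_mat D"
    by (auto simp: diagonal_mat_def D_def two_col_mat_def)
  ultimately show ?thesis
    unfolding real_diagonalizable_def by blast
qed

lemma eigenspace_A00:
  assumes gh: "g * h \<noteq> 0"
  shows "eigenspace A00 um = {q \<in> carrier_vec (2 * N + 3). q $ 0 = 0 \<and> q $ 1 = 0}"
proof -
  have "A00 *\<^sub>v q = um \<cdot>\<^sub>v q"
    if "q \<in> carrier_vec (2 * N + 3)" "q $ 0 = 0" "q $ 1 = 0" for q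
    using hswme_A_carrier that(1)
    by (rule mult_mat_vec_eq_smult)
      (use that in \<open>auto simp: A00_eq_two_col_mat two_col_mat_def\<close>)
  then show ?thesis
    unfolding eigenspace_def
    using hswme_A_carrier[of N g h um vm 0 0] A0_eigenvector_leading[OF gh] by auto
qed

end

section \<open>Real spectrum, eigenspaces and diagonalizability together\<close>

theorem theorem4p1:
  fixes N :: nat and g h um vm \<alpha>1 \<beta>1 :: real and A :: "real mat" and E :: "real vec set"
  assumes N: "N \<ge> 1" and g: "g > 0" and h: "h > 0"
    and \<alpha>1: "\<alpha>1 = 0"
    and A_def: "A = hswme_A N g h um vm \<alpha>1 \<beta>1"
    and E_def: "E = eigenspace A um"
  shows "(\<forall>z::complex. eigenvalue (map_mat complex_of_real A) z \<longrightarrow> z \<in> \<real>)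
    \<and> spectrum A = {um + sqrt (g * h), um - sqrt (g * h), um}
    \<and> char_poly A =
        [:- (um + sqrt (g * h)), 1:] * [:- (um - sqrt (g * h)), 1:] * (\<Prod>i = 3..2 * N + 3. [:- um, 1:])
    \<and> (\<beta>1 = 0 \<longrightarrow>
          E = {q \<in> carrier_vec (2 * N + 3). q $ 0 = 0 \<and> q $ 1 = 0}
        \<and> subspace_dim (2 * N + 3) E = 2 * N + 1
        \<and> real_diagonalizable A)
    \<and> (\<beta>1 \<noteq> 0 \<longrightarrow>
          E = {q \<in> carrier_vec (2 * N + 3). \<forall>i\<in>{1..N + 2}. q $ (i - 1) = 0}
        \<and> subspace_dim (2 * N + 3) E = N + 1
        \<and> \<not> real_diagonalizable A)"
proof -
  let ?s = "sqrt (g * h)" and ?n = "2 * N + 3"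
  have gh: "g * h > 0" using g h by simp
  have A: "A \<in> carrier_mat ?n ?n" unfolding A_def by (rule hswme_A_carrier)
  have cp: "char_poly A = [:- (um + ?s), 1:] * [:- (um - ?s), 1:] * [:- um, 1:] ^ (2 * N + 1)"
    unfolding A_def \<alpha>1 by (rule char_poly_A0[OF gh])
  have "z \<in> \<real>" if "eigenvalue (map_mat complex_of_real A) z" for z
  proof -
    interpret map_poly_hom: map_poly_comm_ring_hom complex_of_real ..
    \<comment> \<open>Reality is checked over the complex numbers, where the characteristic
      polynomial still splits into the same real linear factors.\<close>
    have "poly (map_poly complex_of_real (char_poly A)) z = 0"
      using that A by (simp add: eigenvalue_root_char_poly[of _ ?n] of_real_hom.char_poly_hom[OF A])
    also have "map_poly complex_of_real (char_poly A) = [:- of_real (um + ?s), 1:] *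
        [:- of_real (um - ?s), 1:] * [:- of_real um, 1:] ^ (2 * N + 1)"
      unfolding cp map_poly_hom.hom_mult map_poly_hom.hom_power by simp
    finally have "z = of_real (um + ?s) \<or> z = of_real (um - ?s) \<or> z = of_real um"
      by (subst (asm) poly_linear_factors_eq_0_iff) simp_all
    then show ?thesis by auto
  qed
  moreover have "spectrum A = {um + ?s, um - ?s, um}"
    unfolding spectrum_def eigenvalue_root_char_poly[OF A] cp
    by (subst poly_linear_factors_eq_0_iff) auto
  \<comment> \<open>The index range from 3 to \<open>2 * N + 3\<close> contributes
    \<open>2 * N + 1\<close> equal factors.\<close>
  moreover have "char_poly A = [:- (um + ?s), 1:] * [:- (um - ?s), 1:] * (\<Prod>i = 3..?n. [:- um, 1:])"
    unfolding cp by simp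
  moreover have "E = {q \<in> carrier_vec ?n. q $ 0 = 0 \<and> q $ 1 = 0}
      \<and> subspace_dim ?n E = 2 * N + 1 \<and> real_diagonalizable A" if "\<beta>1 = 0"
  proof -
    have E: "E = {q \<in> carrier_vec ?n. q $ 0 = 0 \<and> q $ 1 = 0}"
      using eigenspace_A00[of g h N um vm] g h by (simp add: E_def A_def \<alpha>1 that)
    also have "\<dots> = {q \<in> carrier_vec ?n. \<forall>i<2. q $ i = 0}"
      by (auto simp: less_2_cases_iff)
    finally have "subspace_dim ?n E = 2 * N + 1"
      using subspace_dim_initial_zeros[of 2 ?n] by simp
    with E show ?thesis
      using A00_diagonalizable[OF gh] by (simp add: A_def \<alpha>1 that)
  qed
  moreover have "E = {q \<in> carrier_vec ?n. \<forall>i\<in>{1..N + 2}. q $ (i - 1) = 0}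
      \<and> subspace_dim ?n E = N + 1 \<and> \<not> real_diagonalizable A" if "\<beta>1 \<noteq> 0"
  proof -
    have E: "E = {q \<in> carrier_vec ?n. \<forall>i<N + 2. q $ i = 0}"
      using eigenspace_A0_nonzero[of g h \<beta>1 N um vm] g h that by (simp add: E_def A_def \<alpha>1)
    \<comment> \<open>This passes from index origin 0 to index origin 1.\<close>
    have "(\<forall>i<N + 2. q $ i = 0) \<longleftrightarrow> (\<forall>i\<in>{1..N + 2}. q $ (i - 1) = 0)" for q :: "real vec"
    proof -
      have "{1..N + 2} = Suc ` {..<N + 2}"
        by (simp add: lessThan_atLeast0 image_Suc_atLeastLessThan atLeastLessThanSuc_atLeastAtMost)
      then show ?thesis by auto
    qed
    moreover have "subspace_dim ?n E = N + 1"
      using subspace_dim_initial_zeros[of "N + 2" ?n] by (simp add: E)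
    ultimately show ?thesis
      using A0_not_diagonalizable[OF N that] by (simp add: A_def \<alpha>1 E)
  qed
  ultimately show ?thesis by blast
qed

end
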